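(* Let $s,t,a,b$ be integers with $2\le a\le s$ and $2\le b\le t$. Then $$r\!\left(K_{n,n},K_{s,t},st-ab+2\right)\ge (1-o(1))\left(\frac{n}{\max\{a,b\}-1}\right)^{1/\min\{a,b\}},$$ where $o(1)$ denotes a quantity tending to $0$ as $n\to\infty$ (with $s,t,a,b$ fixed).
   Context: For graphs $G,H$ and an integer $q$ with $2\le q\le |E(H)|$, an $(H,q)$-coloring of $G$ is an edge-coloring of $G$ in which every subgraph of $G$ isomorphic to $H$ receives at least $q$ distinct colors; $r(G,H,q)$ is the minimum number of colors needed for $G$ to have an $(H,q)$-coloring. $K_{n,n}$, $K_{s,t}$ denote complete bipartite graphs. *)

theory Defs
  imports Complex_Main
begin

record 'a ugraph =
  verts :: "'a set"
  edges :: "'a set set"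

text \<open>Simple graphs: an edge is a set of exactly two vertices, so there are no loops and no
  parallel edges.\<close>

definition simple_graph :: "'a ugraph \<Rightarrow> bool" where
  "simple_graph G \<longleftrightarrow> (\<forall>e\<in>edges G. e \<subseteq> verts G \<and> card e = 2)"

definition subgraph :: "'a ugraph \<Rightarrow> 'a ugraph \<Rightarrow> bool" where
  "subgraph F G \<longleftrightarrow> simple_graph F \<and> verts F \<subseteq> verts G \<and> edges F \<subseteq> edges G"

definition graph_iso :: "'a ugraph \<Rightarrow> 'b ugraph \<Rightarrow> bool" where
  "graph_iso F H \<longleftrightarrow>
     (\<exists>f. bij_betw f (verts F) (verts H) \<and>
          (\<forall>u\<in>verts F. \<forall>v\<in>verts F. {u, v} \<in> edges F \<longleftrightarrow> {f u, f v} \<in> edges H))"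

definition complete_bipartite :: "nat \<Rightarrow> nat \<Rightarrow> (nat + nat) ugraph" where
  "complete_bipartite m n =
     \<lparr>verts = {..<m} <+> {..<n}, edges = {{Inl i, Inr j} | i j. i < m \<and> j < n}\<rparr>"

text \<open>An edge-coloring is an arbitrary function on the edges (adjacent edges may receive the same
  color); its values outside \<^term>\<open>edges G\<close> are irrelevant.\<close>

definition Hq_coloring :: "'a ugraph \<Rightarrow> 'b ugraph \<Rightarrow> nat \<Rightarrow> ('a set \<Rightarrow> nat) \<Rightarrow> bool" where
  "Hq_coloring G H q c \<longleftrightarrow>
     (\<forall>F. subgraph F G \<and> graph_iso F H \<longrightarrow> q \<le> card (c ` edges F))"

text \<open>For finite \<^term>\<open>G\<close> and \<^term>\<open>q \<le> card (edges H)\<close> the minimum is over a nonempty set of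
  numbers, see \<open>Hq_coloring_exists\<close> below.\<close>

definition gen_ramsey :: "'a ugraph \<Rightarrow> 'b ugraph \<Rightarrow> nat \<Rightarrow> nat" where
  "gen_ramsey G H q = (LEAST k. \<exists>c. c ` edges G \<subseteq> {..<k} \<and> Hq_coloring G H q c)"

lemma simple_graph_complete_bipartite: "simple_graph (complete_bipartite m n)"
  by (auto simp: simple_graph_def complete_bipartite_def)

lemma edges_complete_bipartite:
  "edges (complete_bipartite m n) = (\<lambda>(i, j). {Inl i, Inr j}) ` ({..<m} \<times> {..<n})"
  by (auto simp: complete_bipartite_def)

lemma finite_edges_complete_bipartite: "finite (edges (complete_bipartite m n))"
  by (simp add: edges_complete_bipartite)

lemma card_edges_complete_bipartite: "card (edges (complete_bipartite m n)) = m * n"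
proof -
  have "inj_on (\<lambda>(i, j). {Inl i, Inr j} :: (nat + nat) set) ({..<m} \<times> {..<n})"
    by (auto simp: inj_on_def doubleton_eq_iff)
  then show ?thesis
    by (simp add: edges_complete_bipartite card_image card_cartesian_product)
qed

lemma simple_graph_edge:
  assumes "simple_graph G" "e \<in> edges G"
  shows "\<exists>u v. e = {u, v}"
proof -
  have "card e = 2" using assms by (simp add: simple_graph_def)
  then show ?thesis unfolding card_2_iff by blast
qed

lemma graph_iso_edges:
  assumes "simple_graph F" "simple_graph H"
    and f: "bij_betw f (verts F) (verts H)"
    and adj: "\<forall>u\<in>verts F. \<forall>v\<in>verts F. {u, v} \<in> edges F \<longleftrightarrow> {f u, f v} \<in> edges H"
  shows "bij_betw (image f) (edges F) (edges H)"
proof -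
  have "inj_on (image f) (edges F)"
  proof (rule inj_onI)
    fix d e assume "d \<in> edges F" "e \<in> edges F" "f ` d = f ` e"
    moreover from this have "d \<subseteq> verts F" "e \<subseteq> verts F"
      using assms(1) by (simp_all add: simple_graph_def)
    ultimately show "d = e"
      using f inj_on_image_eq_iff[of f "verts F" d e] by (simp add: bij_betw_def)
  qed
  moreover have "f ` e \<in> edges H" if e: "e \<in> edges F" for e
  proof -
    obtain u v where uv: "e = {u, v}"
      using simple_graph_edge[OF assms(1) e] by blast
    moreover have "e \<subseteq> verts F" using e assms(1) by (simp add: simple_graph_def)
    ultimately show ?thesis using e uv adj by simp
  qed
  moreover have "e \<in> image f ` edges F" if e: "e \<in> edges H" for e
  proof -
    obtain x y where xy: "e = {x, y}"
      using simple_graph_edge[OF assms(2) e] by blast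
    then have "x \<in> f ` verts F" "y \<in> f ` verts F"
      using e assms(2) f by (auto simp: simple_graph_def bij_betw_def)
    then obtain u v where "u \<in> verts F" "v \<in> verts F" "x = f u" "y = f v" by blast
    then have "{u, v} \<in> edges F" "e = f ` {u, v}" using adj e xy by auto
    then show ?thesis by blast
  qed
  ultimately show ?thesis by (auto simp: bij_betw_def)
qed

lemma Hq_coloring_exists:
  assumes "finite (edges G)" "simple_graph H" "q \<le> card (edges H)"
  shows "\<exists>k c. c ` edges G \<subseteq> {..<k} \<and> Hq_coloring G H q c"
proof -
  obtain c where c: "bij_betw c (edges G) {0..<card (edges G)}"
    using ex_bij_betw_finite_nat[OF assms(1)] by blast
  have "q \<le> card (c ` edges F)" if FG: "subgraph F G" and FH: "graph_iso F H" for F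
  proof -
    have "card (edges F) = card (edges H)"
    proof -
      obtain f where "bij_betw f (verts F) (verts H)"
        "\<forall>u\<in>verts F. \<forall>v\<in>verts F. {u, v} \<in> edges F \<longleftrightarrow> {f u, f v} \<in> edges H"
        using FH unfolding graph_iso_def by blast
      moreover have "simple_graph F" using FG by (simp add: subgraph_def)
      ultimately show ?thesis using graph_iso_edges[OF _ assms(2)] bij_betw_same_card by blast
    qed
    moreover have "inj_on c (edges F)"
      using c FG inj_on_subset unfolding bij_betw_def subgraph_def by blast
    ultimately show ?thesis using assms(3) by (simp add: card_image)
  qed
  then have "Hq_coloring G H q c" by (auto simp: Hq_coloring_def)
  moreover have "c ` edges G \<subseteq> {..<card (edges G)}" using c by (auto simp: bij_betw_def)
  ultimately show ?thesis by blast
qed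

end

(* A monochromatic K_{a,b} extends to a copy of K_{s,t} with at most st - ab + 1 colors, so in a
   valid coloring with k colors every m = min a b left vertices have, in each color, at most
   D = max a b - 1 common neighbours.  Count the triples (xs, y, c) where xs is an m-tuple of left
   vertices all joined to y in color c.  By convexity there are at least k n (n/k)^m of them.
   Tuples of distinct vertices contribute at most k D n^m, the others at most m^2 n^m, because
   there a pair (xs, y) determines c.  Hence n \<le> D k^m + m^2 k^(m-1) \<le> D (k + m^2)^m. *)

theory Submission
  imports Defs
begin

section \<open>Tuples with repetitions, and convexity\<close>

text \<open>By induction on \<open>m\<close>: a list with a repetition either has one in its tail,
  or its head equals one of the \<open>m\<close> entries of the tail. The two cases add up because
  m^2 + m \<le> (m + 1)^2. The factor \<open>card A\<close> on the left replaces a division on the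
  right.\<close>

lemma card_nondistinct_lists:
  assumes "finite A"
  shows "card A * card {xs. set xs \<subseteq> A \<and> length xs = m \<and> \<not> distinct xs} \<le> m\<^sup>2 * card A ^ m"
proof (induction m)
  case 0
  have "{xs. set xs \<subseteq> A \<and> length xs = 0 \<and> \<not> distinct xs} = {}" by auto
  then show ?case by (simp only: card.empty)
next
  case (Suc m)
  let ?N = "\<lambda>m. {xs. set xs \<subseteq> A \<and> length xs = m \<and> \<not> distinct xs}"
  let ?L = "{xs. set xs \<subseteq> A \<and> length xs = m}"
  have finL: "finite ?L" using assms by (rule finite_lists_length_eq)
  then have finN: "finite (?N m)" by (rule rev_finite_subset) auto
  have sub: "?N (Suc m) \<subseteq> (\<lambda>(x, xs). x # xs) ` (A \<times> ?N m) \<union>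
      (\<lambda>(xs, i). xs ! i # xs) ` (?L \<times> {..<m})"
  proof
    fix ys assume "ys \<in> ?N (Suc m)"
    then obtain x xs where ys: "ys = x # xs" "x \<in> A" "set xs \<subseteq> A" "length xs = m"
      "\<not> distinct xs \<or> x \<in> set xs"
      by (cases ys) auto
    show "ys \<in> (\<lambda>(x, xs). x # xs) ` (A \<times> ?N m) \<union> (\<lambda>(xs, i). xs ! i # xs) ` (?L \<times> {..<m})"
    proof (cases "distinct xs")
      case True
      then obtain i where "i < m" "xs ! i = x" using ys by (auto simp: in_set_conv_nth)
      then have "ys = (\<lambda>(xs, i). xs ! i # xs) (xs, i)" "(xs, i) \<in> ?L \<times> {..<m}" using ys by auto
      then show ?thesis by blast
    next
      case False
      then have "ys = (\<lambda>(x, xs). x # xs) (x, xs)" "(x, xs) \<in> A \<times> ?N m" using ys by auto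
      then show ?thesis by blast
    qed
  qed
  have "card (?N (Suc m)) \<le> card ((\<lambda>(x, xs). x # xs) ` (A \<times> ?N m) \<union>
      (\<lambda>(xs, i). xs ! i # xs) ` (?L \<times> {..<m}))"
    using sub assms finL finN by (intro card_mono) auto
  also have "\<dots> \<le> card ((\<lambda>(x, xs). x # xs) ` (A \<times> ?N m)) +
      card ((\<lambda>(xs, i). xs ! i # xs) ` (?L \<times> {..<m}))"
    by (rule card_Un_le)
  also have "\<dots> \<le> card (A \<times> ?N m) + card (?L \<times> {..<m})"
    using assms finL finN by (intro add_mono card_image_le) auto
  also have "\<dots> = card A * card (?N m) + m * card A ^ m"
    using assms by (simp add: card_cartesian_product card_lists_length_eq)
  also have "\<dots> \<le> m\<^sup>2 * card A ^ m + m * card A ^ m"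
    using Suc.IH by simp
  also have "\<dots> \<le> (Suc m)\<^sup>2 * card A ^ m"
    by (simp add: power2_eq_square algebra_simps)
  finally have "card A * card (?N (Suc m)) \<le> card A * ((Suc m)\<^sup>2 * card A ^ m)"
    by (rule mult_left_mono) simp
  then show ?case by (simp add: ac_simps)
qed

text \<open>Summing the tangent line of \<open>x ^ m\<close> at \<open>\<mu>\<close>.\<close>

lemma sum_power_ge_mean:
  fixes f :: "'a \<Rightarrow> real"
  assumes f: "\<And>i. i \<in> I \<Longrightarrow> 0 \<le> f i" and mu: "0 < \<mu>" and mean: "(\<Sum>i\<in>I. f i) = real (card I) * \<mu>"
  shows "real (card I) * \<mu> ^ m \<le> (\<Sum>i\<in>I. f i ^ m)"
proof -
  have "\<mu> ^ m * (1 + real m * (f i / \<mu> - 1)) \<le> f i ^ m" if "i \<in> I" for i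
  proof -
    \<comment> \<open>Bernoulli applies because \<open>f i / \<mu> - 1\<close> is at least -1.
      Scaling by \<open>\<mu> ^ m\<close> turns it into the tangent line at
      \<open>\<mu>\<close>.\<close>
    have "1 + real m * (f i / \<mu> - 1) \<le> (1 + (f i / \<mu> - 1)) ^ m"
      using f[OF that] mu by (intro Bernoulli_inequality) simp
    then have "\<mu> ^ m * (1 + real m * (f i / \<mu> - 1)) \<le> \<mu> ^ m * (f i / \<mu>) ^ m"
      using mu by (intro mult_left_mono) auto
    then show ?thesis using mu by (simp add: power_divide)
  qed
  then have "(\<Sum>i\<in>I. \<mu> ^ m * (1 + real m * (f i / \<mu> - 1))) \<le> (\<Sum>i\<in>I. f i ^ m)"
    by (rule sum_mono)
  \<comment> \<open>The linear part has total weight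
    \<open>(\<Sum>i\<in>I. f i) / \<mu> - real (card I)\<close>, which vanishes by
    \<open>mean\<close>.\<close>
  moreover have "(\<Sum>i\<in>I. \<mu> ^ m * (1 + real m * (f i / \<mu> - 1))) =
      \<mu> ^ m * (real (card I) + real m * ((\<Sum>i\<in>I. f i) / \<mu> - real (card I)))"
    by (simp add: sum_distrib_left[symmetric] sum.distrib sum_subtractf sum_divide_distrib)
  ultimately show ?thesis using mu mean by (simp add: mult.commute)
qed

text \<open>Every pair (x, y) has exactly one color and is therefore counted once. This fixes the
  average color degree for the convexity step below.\<close>

lemma sum_card_fibres:
  assumes "finite A" "finite B" "finite C"
    and col: "\<And>x y. x \<in> A \<Longrightarrow> y \<in> B \<Longrightarrow> col x y \<in> C"
  shows "(\<Sum>(c, y)\<in>C \<times> B. card {x \<in> A. col x y = c}) = card A * card B"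
proof -
  have "(\<Sum>(c, y)\<in>C \<times> B. card {x \<in> A. col x y = c}) =
      (\<Sum>y\<in>B. \<Sum>c\<in>C. \<Sum>x\<in>A. if col x y = c then 1 else 0)"
    using assms(1) by (subst sum.swap) (simp add: sum.cartesian_product sum.If_cases Int_def)
  also have "\<dots> = (\<Sum>y\<in>B. \<Sum>x\<in>A. \<Sum>c\<in>C. if col x y = c then 1 else 0)"
    by (intro sum.cong refl sum.swap)
  also have "\<dots> = (\<Sum>y\<in>B. \<Sum>x\<in>A. 1)"
    using assms by (intro sum.cong refl) simp
  finally show ?thesis by simp
qed

section \<open>A Kovari-Sos-Turan count over all colors at once\<close>

text \<open>The lower-order term \<open>m\<^sup>2\<close> is absorbed into the base of the power, so
  that an exact m-th root can be taken later and the error becomes a mere additive constant next to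
  \<open>k\<close>.\<close>

lemma multicolor_KST:
  fixes col :: "'a \<Rightarrow> 'b \<Rightarrow> 'c"
  assumes fin: "finite A" "finite B" "finite C"
    and cards: "card A = n" "card B = n" "card C = k"
    and n: "0 < n" and m: "0 < m" and D: "0 < D"
    and col: "\<And>x y. x \<in> A \<Longrightarrow> y \<in> B \<Longrightarrow> col x y \<in> C"
    and common: "\<And>X c. \<lbrakk>X \<subseteq> A; card X = m; c \<in> C\<rbrakk> \<Longrightarrow> card {y \<in> B. \<forall>x\<in>X. col x y = c} \<le> D"
  shows "n \<le> D * (k + m\<^sup>2) ^ m"
proof -
  let ?L = "{xs. set xs \<subseteq> A \<and> length xs = m}"
  let ?N = "{xs. set xs \<subseteq> A \<and> length xs = m \<and> \<not> distinct xs}"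
  let ?M = "\<lambda>xs c y. \<forall>x\<in>set xs. col x y = c"
  \<comment> \<open>The degree of \<open>y\<close> in color \<open>c\<close>. Its m-th power counts
    the triples with this \<open>y\<close> and \<open>c\<close>, repeated entries allowed.\<close>
  define d where "d c y = card {x \<in> A. col x y = c}" for c y
  have "A \<noteq> {}" "B \<noteq> {}" using cards n by auto
  then have "C \<noteq> {}" using col by blast
  then have k: "0 < k" using cards(3) fin(3) card_gt_0_iff[of C] by simp
  have finL: "finite ?L" using fin(1) by (rule finite_lists_length_eq)
  have cardL: "card ?L = n ^ m" using fin cards by (simp add: card_lists_length_eq)
  have pow: "d c y ^ m = (\<Sum>xs\<in>?L. if ?M xs c y then 1 else 0)" for c y
  proof -
    have "d c y ^ m = card {xs. set xs \<subseteq> {x \<in> A. col x y = c} \<and> length xs = m}"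
      unfolding d_def using fin by (simp add: card_lists_length_eq)
    also have "{xs. set xs \<subseteq> {x \<in> A. col x y = c} \<and> length xs = m} = ?L \<inter> {xs. ?M xs c y}"
      by auto
    finally show ?thesis using finL by (simp add: sum.If_cases)
  qed
  have upper: "(\<Sum>c\<in>C. \<Sum>y\<in>B. if ?M xs c y then 1 else 0) \<le> k * D + (if distinct xs then 0 else n)"
    if xs: "xs \<in> ?L" for xs
  proof (cases "distinct xs")
    case True
    have "(\<Sum>y\<in>B. if ?M xs c y then 1 else 0) \<le> D" if "c \<in> C" for c
    proof -
      have "card {y \<in> B. \<forall>x\<in>set xs. col x y = c} \<le> D"
        using common[of "set xs" c] xs True that by (simp add: distinct_card)
      then show ?thesis using fin by (simp add: sum.If_cases Int_def)
    qed
    then have "(\<Sum>c\<in>C. \<Sum>y\<in>B. if ?M xs c y then 1 else 0) \<le> (\<Sum>c\<in>C. D)" by (rule sum_mono)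
    then show ?thesis using True cards by simp
  next
    case False
    \<comment> \<open>The set of a tuple with repetitions has fewer than \<open>m\<close> elements,
      so \<open>common\<close> does not apply. One entry \<open>x\<close> already forces the color
      to be \<open>col x y\<close>, so each \<open>y\<close> counts at most once over all
      colors.\<close>
    then obtain x where x: "x \<in> set xs" by (cases xs) auto
    have "(\<Sum>c\<in>C. \<Sum>y\<in>B. if ?M xs c y then 1 else (0::nat)) \<le>
        (\<Sum>c\<in>C. \<Sum>y\<in>B. if col x y = c then 1 else 0)"
      using x by (intro sum_mono) auto
    also have "\<dots> = (\<Sum>y\<in>B. \<Sum>c\<in>C. if col x y = c then 1 else 0)" by (rule sum.swap)
    also have "\<dots> = (\<Sum>y\<in>B. 1)" using fin col x xs by (intro sum.cong refl) auto
    finally show ?thesis using False cards by simp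
  qed
  \<comment> \<open>The triples are regrouped by their tuple in order to apply
    \<open>upper\<close>.\<close>
  have "(\<Sum>(c, y)\<in>C \<times> B. d c y ^ m) = (\<Sum>c\<in>C. \<Sum>y\<in>B. \<Sum>xs\<in>?L. if ?M xs c y then 1 else 0)"
    by (simp only: sum.cartesian_product[symmetric] pow)
  also have "\<dots> = (\<Sum>c\<in>C. \<Sum>xs\<in>?L. \<Sum>y\<in>B. if ?M xs c y then 1 else 0)"
    by (intro sum.cong refl sum.swap)
  also have "\<dots> = (\<Sum>xs\<in>?L. \<Sum>c\<in>C. \<Sum>y\<in>B. if ?M xs c y then 1 else 0)"
    by (rule sum.swap)
  also have "\<dots> \<le> (\<Sum>xs\<in>?L. k * D + (if distinct xs then 0 else n))"
    by (rule sum_mono) (rule upper)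
  also have "\<dots> = n ^ m * (k * D) + n * card ?N"
  proof -
    have "?L \<inter> {xs. \<not> distinct xs} = ?N" by auto
    then show ?thesis using finL by (simp add: sum.distrib cardL sum.If_cases Collect_neg_eq)
  qed
  also have "\<dots> \<le> n ^ m * (k * D) + m\<^sup>2 * n ^ m"
    using card_nondistinct_lists[OF fin(1), of m] cards by simp
  finally have le: "(\<Sum>(c, y)\<in>C \<times> B. d c y ^ m) \<le> n ^ m * (k * D + m\<^sup>2)"
    by (simp add: algebra_simps)
  \<comment> \<open>Convexity over the k n pairs (c, y): the degrees sum to n^2, so their mean is
    n/k.\<close>
  have "real (card (C \<times> B)) * (real n / real k) ^ m \<le>
      (\<Sum>p\<in>C \<times> B. real (d (fst p) (snd p)) ^ m)"
  proof (rule sum_power_ge_mean)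
    have "(\<Sum>p\<in>C \<times> B. d (fst p) (snd p)) = n * n"
      using sum_card_fibres[OF fin, of col] col cards by (simp add: d_def case_prod_beta)
    then have "(\<Sum>p\<in>C \<times> B. real (d (fst p) (snd p))) = real (n * n)"
      by (simp only: of_nat_sum[symmetric])
    then show "(\<Sum>p\<in>C \<times> B. real (d (fst p) (snd p))) = real (card (C \<times> B)) * (real n / real k)"
      using k cards by (simp add: card_cartesian_product)
  qed (use n k in auto)
  also have "\<dots> = real (\<Sum>(c, y)\<in>C \<times> B. d c y ^ m)"
    by (simp add: case_prod_beta)
  also have "\<dots> \<le> real (n ^ m * (k * D + m\<^sup>2))"
    using le by (rule of_nat_mono)
  finally have "real n ^ m * (real k * real n / real k ^ m) \<le> real n ^ m * (real k * D + (real m)\<^sup>2)"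
    by (simp add: card_cartesian_product cards power_divide mult.commute)
  then have "real k * real n / real k ^ m \<le> real k * D + (real m)\<^sup>2"
    by (rule mult_left_le_imp_le) (use n in simp)
  moreover obtain j where j: "m = Suc j" using m by (cases m) auto
  ultimately have "real n \<le> (real k * D + (real m)\<^sup>2) * real k ^ j"
    using k by (simp add: field_simps)
  then have "real n \<le> real ((k * D + m\<^sup>2) * k ^ j)" by simp
  then have "n \<le> (k * D + m\<^sup>2) * k ^ j" by (simp only: of_nat_le_iff)
  \<comment> \<open>Since D \<ge> 1, the term \<open>m\<^sup>2\<close> is at most
    \<open>D * m\<^sup>2\<close>, and \<open>D\<close> factors out.\<close>
  also have "\<dots> \<le> (D * (k + m\<^sup>2)) * (k + m\<^sup>2) ^ j"
    using D by (intro mult_mono power_mono) (auto simp: algebra_simps)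
  finally show ?thesis by (simp add: j ac_simps)
qed

section \<open>Monochromatic bicliques in an (H,q)-coloring\<close>

text \<open>The image of \<open>H\<close> under an injection, taken with the image edges only, is a
  copy of \<open>H\<close> in \<open>G\<close>. Copies can thus be given by explicit vertex
  maps.\<close>

lemma Hq_coloring_embedding:
  assumes c: "Hq_coloring G H q c" and H: "simple_graph H"
    and inj: "inj_on \<phi> (verts H)" and "\<phi> ` verts H \<subseteq> verts G" "image \<phi> ` edges H \<subseteq> edges G"
  shows "q \<le> card (c ` image \<phi> ` edges H)"
proof -
  let ?F = "\<lparr>verts = \<phi> ` verts H, edges = image \<phi> ` edges H\<rparr>"
  have sub: "e \<subseteq> verts H" "card e = 2" if "e \<in> edges H" for e
    using H that by (auto simp: simple_graph_def)
  have "simple_graph ?F"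
    using sub inj_on_subset[OF inj] by (fastforce simp: simple_graph_def card_image)
  then have "subgraph ?F G" using assms by (simp add: subgraph_def)
  moreover have "graph_iso ?F H"
    unfolding graph_iso_def
  proof (intro exI conjI ballI)
    \<comment> \<open>\<open>graph_iso\<close> asks for a map from the copy to \<open>H\<close>,
      hence the inverse of \<open>\<phi>\<close>.\<close>
    show "bij_betw (inv_into (verts H) \<phi>) (verts ?F) (verts H)"
      using inj by (simp add: bij_betw_inv_into inj_on_imp_bij_betw)
    fix u v assume "u \<in> verts ?F" "v \<in> verts ?F"
    then obtain x y where xy: "x \<in> verts H" "y \<in> verts H" "u = \<phi> x" "v = \<phi> y" by auto
    have "{\<phi> x, \<phi> y} \<in> image \<phi> ` edges H \<longleftrightarrow> {x, y} \<in> edges H"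
    proof
      assume "{\<phi> x, \<phi> y} \<in> image \<phi> ` edges H"
      then obtain e where e: "e \<in> edges H" "\<phi> ` {x, y} = \<phi> ` e" by auto
      then have "{x, y} = e"
        using inj_on_image_eq_iff[OF inj, of "{x, y}" e] sub xy by simp
      then show "{x, y} \<in> edges H" using e by simp
    next
      assume "{x, y} \<in> edges H"
      then have "\<phi> ` {x, y} \<in> image \<phi> ` edges H" by (rule imageI)
      then show "{\<phi> x, \<phi> y} \<in> image \<phi> ` edges H" by simp
    qed
    then show "{u, v} \<in> edges ?F \<longleftrightarrow>
        {inv_into (verts H) \<phi> u, inv_into (verts H) \<phi> v} \<in> edges H"
      using xy inj by simp
  qed
  ultimately have "q \<le> card (c ` edges ?F)" using c unfolding Hq_coloring_def by blast
  then show ?thesis by simp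
qed

text \<open>The set \<open>T\<close> contributes the single value \<open>z\<close>, and each
  remaining element at most one further value.\<close>

lemma card_image_constant_on:
  assumes "finite S" "T \<subseteq> S" and const: "\<And>x. x \<in> T \<Longrightarrow> f x = z"
  shows "card (f ` S) \<le> card S - card T + 1"
proof -
  have "f ` S \<subseteq> insert z (f ` (S - T))" using const by auto
  then have "card (f ` S) \<le> card (insert z (f ` (S - T)))"
    using assms(1) by (intro card_mono) auto
  also have "\<dots> \<le> card (f ` (S - T)) + 1"
    using assms(1) by (simp add: card_insert_if)
  also have "card (f ` (S - T)) \<le> card (S - T)" using assms(1) by (intro card_image_le) auto
  also have "card (S - T) = card S - card T"
    using assms finite_subset by (intro card_Diff_subset) auto
  finally show ?thesis by simp
qed

text \<open>A bijection from the first \<open>a\<close> indices to \<open>X\<close> is completed by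
  one between the complements, which have equal size. It serves to move the initial biclique of
  K_{s,t} onto prescribed vertices.\<close>

lemma extend_to_permutation:
  assumes "X \<subseteq> {..<n}" "card X = a"
  obtains f where "bij_betw f {..<n} {..<n}" "f ` {..<a} = X"
proof -
  have fin: "finite X" using assms finite_subset by blast
  have an: "a \<le> n" using assms card_mono[of "{..<n}" X] by simp
  obtain g where g: "bij_betw g {..<a} X"
    using finite_same_card_bij[of "{..<a}" X] fin assms by auto
  obtain h where h: "bij_betw h {a..<n} ({..<n} - X)"
    using finite_same_card_bij[of "{a..<n}" "{..<n} - X"] fin assms by (auto simp: card_Diff_subset)
  let ?f = "\<lambda>i. if i < a then g i else h i"
  have "bij_betw ?f {..<a} X" using g by (subst bij_betw_cong[of _ _ g]) auto
  moreover have "bij_betw ?f {a..<n} ({..<n} - X)" using h by (subst bij_betw_cong[of _ _ h]) auto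
  ultimately have "bij_betw ?f ({..<a} \<union> {a..<n}) (X \<union> ({..<n} - X))"
    by (rule bij_betw_combine) auto
  moreover have "{..<a} \<union> {a..<n} = {..<n}" "X \<union> ({..<n} - X) = {..<n}" using an assms by auto
  ultimately have "bij_betw ?f {..<n} {..<n}" by simp
  moreover have "?f ` {..<a} = X" using g by (auto simp: bij_betw_def)
  ultimately show thesis by (rule that)
qed

text \<open>The a b edges between the initial indices share one color, and the other st - ab edges
  add at most one color each. The threshold st - ab + 2 is the first value that this
  excludes.\<close>

lemma Hq_coloring_monochromatic_biclique:
  assumes c: "Hq_coloring G (complete_bipartite s t) q c"
    and \<phi>: "inj_on \<phi> (verts (complete_bipartite s t))"
      "\<phi> ` verts (complete_bipartite s t) \<subseteq> verts G"
      "image \<phi> ` edges (complete_bipartite s t) \<subseteq> edges G"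
    and "a \<le> s" "b \<le> t"
    and const: "\<And>i j. i < a \<Longrightarrow> j < b \<Longrightarrow> c {\<phi> (Inl i), \<phi> (Inr j)} = z"
  shows "q \<le> s * t - a * b + 1"
proof -
  let ?H = "complete_bipartite s t" and ?K = "complete_bipartite a b"
  have "q \<le> card (c ` image \<phi> ` edges ?H)"
    using c simple_graph_complete_bipartite \<phi> by (rule Hq_coloring_embedding)
  also have "\<dots> = card ((\<lambda>e. c (\<phi> ` e)) ` edges ?H)" by (simp add: image_image)
  also have "\<dots> \<le> card (edges ?H) - card (edges ?K) + 1"
  proof (rule card_image_constant_on)
    show "edges ?K \<subseteq> edges ?H"
      using assms(5,6) by (fastforce simp: complete_bipartite_def)
    show "c (\<phi> ` e) = z" if "e \<in> edges ?K" for e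
      using that const by (auto simp: complete_bipartite_def)
  qed (rule finite_edges_complete_bipartite)
  finally show ?thesis by (simp add: card_edges_complete_bipartite)
qed

text \<open>Permutations of the two sides of K_{n,n} place a K_{s,t} around the biclique on
  \<open>X\<close> and \<open>Y\<close>. Both size patterns occur: \<open>X\<close> will be the
  smaller class and lies on the left, while either of \<open>a\<close> and \<open>b\<close> may be
  the smaller number.\<close>

lemma no_monochromatic_biclique:
  assumes c: "Hq_coloring (complete_bipartite n n) (complete_bipartite s t) (s * t - a * b + 2) c"
    and le: "a \<le> s" "b \<le> t" "s \<le> n" "t \<le> n"
    and XY: "X \<subseteq> {..<n}" "Y \<subseteq> {..<n}"
    and card: "card X = a \<and> card Y = b \<or> card X = b \<and> card Y = a"
    and const: "\<And>x y. x \<in> X \<Longrightarrow> y \<in> Y \<Longrightarrow> c {Inl x, Inr y} = z"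
  shows False
proof -
  have "s * t - a * b + 2 \<le> s * t - a * b + 1"
    using card
  proof
    assume "card X = a \<and> card Y = b"
    then obtain f g where f: "bij_betw f {..<n} {..<n}" "f ` {..<a} = X"
      and g: "bij_betw g {..<n} {..<n}" "g ` {..<b} = Y"
      using extend_to_permutation XY by metis
    have fn: "f i < n" if "i < n" for i using f that by (auto simp: bij_betw_def)
    have gn: "g i < n" if "i < n" for i using g that by (auto simp: bij_betw_def)
    have "inj_on f {..<n}" "inj_on g {..<n}" using f g by (auto simp: bij_betw_def)
    then have "inj_on (map_sum f g) (verts (complete_bipartite s t))"
      using le by (auto simp: complete_bipartite_def inj_on_def)
    with c show ?thesis
    proof (rule Hq_coloring_monochromatic_biclique)
      show "map_sum f g ` verts (complete_bipartite s t) \<subseteq> verts (complete_bipartite n n)"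
        using le fn gn by (auto simp: complete_bipartite_def)
      show "image (map_sum f g) ` edges (complete_bipartite s t) \<subseteq> edges (complete_bipartite n n)"
        using le fn gn by (fastforce simp: complete_bipartite_def)
      show "c {map_sum f g (Inl i), map_sum f g (Inr j)} = z" if "i < a" "j < b" for i j
        using const[of "f i" "g j"] f g that by auto
    qed (rule le)+
  next
    assume "card X = b \<and> card Y = a"
    then obtain f g where f: "bij_betw f {..<n} {..<n}" "f ` {..<a} = Y"
      and g: "bij_betw g {..<n} {..<n}" "g ` {..<b} = X"
      using extend_to_permutation XY by metis
    \<comment> \<open>Here the \<open>a\<close>-class lies on the right, so K_{s,t} is embedded with
      its sides exchanged.\<close>
    let ?\<phi> = "case_sum (Inr \<circ> f) (Inl \<circ> g) :: nat + nat \<Rightarrow> nat + nat"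
    have fn: "f i < n" if "i < n" for i using f that by (auto simp: bij_betw_def)
    have gn: "g i < n" if "i < n" for i using g that by (auto simp: bij_betw_def)
    have "inj_on f {..<n}" "inj_on g {..<n}" using f g by (auto simp: bij_betw_def)
    then have "inj_on ?\<phi> (verts (complete_bipartite s t))"
      using le by (auto simp: complete_bipartite_def inj_on_def)
    with c show ?thesis
    proof (rule Hq_coloring_monochromatic_biclique)
      show "?\<phi> ` verts (complete_bipartite s t) \<subseteq> verts (complete_bipartite n n)"
        using le fn gn by (auto simp: complete_bipartite_def)
      show "image ?\<phi> ` edges (complete_bipartite s t) \<subseteq> edges (complete_bipartite n n)"
        using le fn gn by (fastforce simp: complete_bipartite_def insert_commute)
      show "c {?\<phi> (Inl i), ?\<phi> (Inr j)} = z" if "i < a" "j < b" for i j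
        using const[of "g j" "f i"] f g that by (auto simp: insert_commute)
    qed (rule le)+
  qed
  then show False by simp
qed

section \<open>The bound for fixed n\<close>

text \<open>The counting lemma is applied to an optimal coloring with tuples of size
  \<open>min a b\<close>, which yields the exponent. If such a set had \<open>max a b\<close> common
  neighbours in one color, they would complete a forbidden biclique.\<close>

lemma gen_ramsey_complete_bipartite_bound:
  fixes s t a b n :: nat
  assumes ab: "2 \<le> a" "a \<le> s" "2 \<le> b" "b \<le> t" and n: "s \<le> n" "t \<le> n"
  defines "k \<equiv> gen_ramsey (complete_bipartite n n) (complete_bipartite s t) (s * t - a * b + 2)"
  shows "n \<le> (max a b - 1) * (k + (min a b)\<^sup>2) ^ min a b"
proof -
  let ?G = "complete_bipartite n n" and ?H = "complete_bipartite s t"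
  let ?q = "s * t - a * b + 2"
  \<comment> \<open>These inequalities give \<open>?q \<le> s * t\<close>, so a valid coloring
    exists and the \<open>LEAST\<close> in \<open>gen_ramsey\<close> is attained.\<close>
  have "2 * 2 \<le> a * b" "a * b \<le> s * t" using ab by (simp_all only: mult_le_mono)
  then have "?q \<le> card (edges ?H)" by (simp add: card_edges_complete_bipartite)
  then have "\<exists>k c. c ` edges ?G \<subseteq> {..<k} \<and> Hq_coloring ?G ?H ?q c"
    using finite_edges_complete_bipartite simple_graph_complete_bipartite
    by (intro Hq_coloring_exists)
  from LeastI_ex[OF this] obtain c where
    c: "c ` edges ?G \<subseteq> {..<k}" "Hq_coloring ?G ?H ?q c"
    unfolding k_def gen_ramsey_def by blast
  show ?thesis
  proof (rule multicolor_KST[where A = "{..<n}" and B = "{..<n}" and C = "{..<k}"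
        and col = "\<lambda>x y. c {Inl x, Inr y}"])
    show "c {Inl x, Inr y} \<in> {..<k}" if "x \<in> {..<n}" "y \<in> {..<n}" for x y
    proof -
      have "{Inl x, Inr y} \<in> edges ?G" using that by (auto simp: complete_bipartite_def)
      then show ?thesis using c(1) by blast
    qed
    show "card {y \<in> {..<n}. \<forall>x\<in>X. c {Inl x, Inr y} = z} \<le> max a b - 1"
      if X: "X \<subseteq> {..<n}" "card X = min a b" for X z
    proof (rule ccontr)
      assume "\<not> ?thesis"
      then have "max a b \<le> card {y \<in> {..<n}. \<forall>x\<in>X. c {Inl x, Inr y} = z}" by linarith
      then obtain Y where Y: "Y \<subseteq> {y \<in> {..<n}. \<forall>x\<in>X. c {Inl x, Inr y} = z}" "card Y = max a b"
        by (rule obtain_subset_with_card_n)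
      show False
        using c(2) ab(2,4) n X(1)
      proof (rule no_monochromatic_biclique)
        show "card X = a \<and> card Y = b \<or> card X = b \<and> card Y = a" using X Y by auto
      qed (use Y in auto)
    qed
  qed (use ab n in auto)
qed

section \<open>Passage to the asymptotic bound\<close>

theorem theorem7p1:
  fixes s t a b :: nat
  assumes "2 \<le> a" and "a \<le> s" and "2 \<le> b" and "b \<le> t"
  shows "\<exists>\<epsilon> :: nat \<Rightarrow> real. \<epsilon> \<longlonglongrightarrow> 0 \<and>
    (\<forall>n. real (gen_ramsey (complete_bipartite n n) (complete_bipartite s t) (s * t - a * b + 2))
        \<ge> (1 - \<epsilon> n) * (real n / (real (max a b) - 1)) powr (1 / real (min a b)))"
proof -
  define m D where "m = min a b" and "D = real (max a b) - 1"
  have m: "0 < m" and D: "1 \<le> D" using assms by (auto simp: m_def D_def)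
  define x where "x n = (real n / D) powr (1 / real m)" for n
  define r where
    "r n = real (gen_ramsey (complete_bipartite n n) (complete_bipartite s t) (s * t - a * b + 2))"
    for n
  \<comment> \<open>For n \<ge> max s t the error is chosen so that
    \<open>(1 - \<epsilon> n) * x n\<close> equals \<open>x n - (real m)\<^sup>2\<close>. For
    smaller n, where K_{s,t} may not fit, the value 1 makes the lower bound 0.\<close>
  define \<epsilon> where "\<epsilon> n = (if n < max s t then 1 else (real m)\<^sup>2 / x n)" for n
  have x_le: "x n \<le> r n + (real m)\<^sup>2" if "max s t \<le> n" for n
  proof -
    let ?k = "gen_ramsey (complete_bipartite n n) (complete_bipartite s t) (s * t - a * b + 2)"
    have "n \<le> (max a b - 1) * (?k + m\<^sup>2) ^ m"
      using gen_ramsey_complete_bipartite_bound[OF assms, of n] that by (simp add: m_def)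
    then have "real n \<le> real ((max a b - 1) * (?k + m\<^sup>2) ^ m)" by (rule of_nat_mono)
    moreover have "real (max a b - 1) = D" using assms by (simp add: D_def of_nat_diff)
    ultimately have "real n \<le> D * (r n + (real m)\<^sup>2) ^ m" by (simp add: r_def)
    then have "real n / D \<le> (r n + (real m)\<^sup>2) ^ m" using D by (simp add: field_simps)
    then have "x n \<le> ((r n + (real m)\<^sup>2) ^ m) powr (1 / real m)"
      unfolding x_def using D by (intro powr_mono2) auto
    also have "\<dots> = r n + (real m)\<^sup>2"
    proof -
      \<comment> \<open>\<open>powr_realpow\<close> needs a positive base, which \<open>m\<close>
        supplies whatever \<open>r n\<close> is.\<close>
      have "0 < r n + (real m)\<^sup>2" using m by (simp add: r_def add_nonneg_pos)
      then have "(r n + (real m)\<^sup>2) ^ m = (r n + (real m)\<^sup>2) powr real m"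
        by (rule powr_realpow[symmetric])
      then show ?thesis using m \<open>0 < r n + (real m)\<^sup>2\<close> by (simp only: powr_powr) simp
    qed
    finally show ?thesis .
  qed
  have "(1 - \<epsilon> n) * x n \<le> r n" for n
  proof (cases "n < max s t")
    case True
    then show ?thesis by (simp add: \<epsilon>_def r_def)
  next
    case False
    then have "0 < n" using assms by auto
    then have "0 < x n" using D by (simp add: x_def)
    moreover have "x n \<le> r n + (real m)\<^sup>2" using False by (intro x_le) linarith
    ultimately show ?thesis using False by (simp add: \<epsilon>_def left_diff_distrib)
  qed
  moreover have "\<epsilon> \<longlonglongrightarrow> 0"
  proof -
    \<comment> \<open>The reciprocal of \<open>x n\<close> is a negative power of n/D, and n/D tends
      to infinity.\<close>
    have "filterlim (\<lambda>n. inverse D * real n) at_top sequentially"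
      using D by (intro filterlim_tendsto_pos_mult_at_top[OF tendsto_const _
            filterlim_real_sequentially]) auto
    then have "(\<lambda>n. (inverse D * real n) powr (- (1 / real m))) \<longlonglongrightarrow> 0"
      using m by (intro tendsto_neg_powr) auto
    then have "(\<lambda>n. (real m)\<^sup>2 * (inverse D * real n) powr (- (1 / real m))) \<longlonglongrightarrow> 0"
      by (rule tendsto_mult_right_zero)
    moreover have "(real m)\<^sup>2 * (inverse D * real n) powr (- (1 / real m)) = (real m)\<^sup>2 / x n" for n
      by (simp add: x_def powr_minus divide_inverse mult.commute)
    ultimately have "(\<lambda>n. (real m)\<^sup>2 / x n) \<longlonglongrightarrow> 0" by simp
    moreover have "eventually (\<lambda>n. (real m)\<^sup>2 / x n = \<epsilon> n) sequentially"
      using eventually_ge_at_top[of "max s t"] by eventually_elim (auto simp: \<epsilon>_def)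
    ultimately show ?thesis by (rule Lim_transform_eventually)
  qed
  ultimately show ?thesis unfolding x_def r_def m_def D_def by blast
qed

end
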